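(* Let $(G_m)_{m\in\mathbb{Z}}$ be a generalized Fibonacci sequence, let $a,b$ be integers, let $n\ge 0$ be an integer, and let $x$ be a complex number such that $\Delta := 1-L_b x+(-1)^b x^2\neq 0$. Then $$\begin{aligned} \sum_{k=0}^n x^k k^5 G_{a+bk} = {}& -\frac{1}{\Delta}(n+1)^5 x^{n+1} P(1,n+1) \\ & - \frac{1}{\Delta^2} \left[ (5n^4+30n^3+70n^2+75n+31) x^{n+2} P(2,n+2) - x P(2,1) \right] \\ & - \frac{10}{\Delta^3} \left[ (2n^3+12n^2+25n+18) x^{n+3} P(3,n+3) - 3 x^2 P(3,2) \right] \\ & - \frac{30}{\Delta^4} \left[ (2n^2+10n+13) x^{n+4} P(4,n+4) - 5 x^3 P(4,3) \right] \\ & - \frac{120}{\Delta^5} \left[ (n+3) x^{n+5} P(5,n+5) - 2 x^4 P(5,4) \right] \\ & - \frac{120}{\Delta^6} \left[ x^{n+6} P(6,n+6) - x^5 P(6,5) \right]. \end{aligned}$$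
   Context: A generalized Fibonacci sequence is a sequence $(G_m)_{m\in\mathbb{Z}}$ of complex numbers with $G_{m+2}=G_{m+1}+G_m$ for all integers $m$ (with arbitrary seed $G_0,G_1$). $L_m$ is the Lucas number: $L_0=2$, $L_1=1$, $L_{m+2}=L_{m+1}+L_m$ for all integers $m$ (including negative indices). For given $a,b,x$ and $G$, and for integers $v,w\ge 0$, $P(v,w) = \sum_{k=0}^v \binom{v}{k} (-1)^{(b+1)k} x^k G_{a+bw-bk}$. Convention: $x^0=1$, also for $x=0$. *)

theory Defs
  imports Complex_Main
begin

definition gen_fib :: "(int \<Rightarrow> complex) \<Rightarrow> bool" where
  "gen_fib G \<longleftrightarrow> (\<forall>m. G (m + 2) = G (m + 1) + G m)"

(* The recurrence run forwards for m > 1 and backwards for m < 0;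
   lucas_rec below confirms that it then holds at every integer. *)
function lucas :: "int \<Rightarrow> int" where
  "lucas m =
     (if m = 0 then 2
      else if m = 1 then 1
      else if m > 1 then lucas (m - 1) + lucas (m - 2)
      else lucas (m + 2) - lucas (m + 1))"
  by auto
termination
  by (relation "Wellfounded.measure (\<lambda>m. nat (if m \<ge> 0 then m else 1 - m))") auto

declare lucas.simps [simp del]

lemma lucas_0: "lucas 0 = 2"
  by (simp add: lucas.simps)

lemma lucas_1: "lucas 1 = 1"
  by (simp add: lucas.simps)

lemma lucas_rec: "lucas (m + 2) = lucas (m + 1) + lucas m"
proof (cases "m \<ge> 0")
  case True
  then show ?thesis by (subst lucas.simps) (simp add: algebra_simps)
next
  case False
  then have "lucas m = lucas (m + 2) - lucas (m + 1)"
    by (subst lucas.simps) simp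
  then show ?thesis by simp
qed

definition fibP :: "(int \<Rightarrow> complex) \<Rightarrow> int \<Rightarrow> int \<Rightarrow> complex \<Rightarrow> nat \<Rightarrow> nat \<Rightarrow> complex" where
  "fibP G a b x v w =
     (\<Sum>k=0..v. of_nat (v choose k) * (-1) powi ((b + 1) * int k) * x ^ k
                 * G (a + b * int w - b * int k))"

end

(* By linearity and Binet's formula it suffices to treat G m = t^m, where t is a root of t^2 = t + 1.
   With s = -1/t the other root, P(v,w) = t^(a+bw) (1 - x s^b)^v and
   Delta = (1 - x t^b) (1 - x s^b), so P(v,w) / Delta^v = t^(a+bw) / (1 - x t^b)^v, and the claim
   becomes an identity for the sum of k^5 y^k at y = x t^b, proved by induction on n. *)

theory Submission
  imports Defs
begin

text \<open>Two adjacent values determine the whole sequence: the recurrence can be run upwards and,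
  solved for its last term, downwards.\<close>

lemma gen_fib_eqI:
  assumes G: "gen_fib G" and H: "gen_fib H" and "G 0 = H 0" "G 1 = H 1"
  shows "G m = H m"
proof -
  have G2: "G (k + 2) = G (k + 1) + G k" and H2: "H (k + 2) = H (k + 1) + H k" for k
    using G H unfolding gen_fib_def by blast+
  \<comment> \<open>Strengthened to adjacent pairs, since the recurrence has order two.\<close>
  have "G m = H m \<and> G (m + 1) = H (m + 1)"
  proof (induction m rule: int_induct[where k = 0])
    case base
    then show ?case using assms by simp
  next
    case (step1 i)
    then show ?case using G2[of i] H2[of i] by (simp add: add.commute[of 2])
  next
    case (step2 i)
    then show ?case using G2[of "i - 1"] H2[of "i - 1"] by (simp add: add.commute[of 1])
  qed
  then show ?thesis ..
qed

lemma gen_fib_lincomb: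
  assumes "gen_fib G" "gen_fib H"
  shows "gen_fib (\<lambda>m. A * G m + B * H m)"
  using assms by (simp add: gen_fib_def algebra_simps)

lemma gen_fib_powi:
  assumes "t\<^sup>2 = t + 1"
  shows "gen_fib (\<lambda>m. t powi m)"
proof -
  have "t \<noteq> 0" using assms by auto
  then have "t powi (m + 2) = t powi m * (t + 1)" for m
    using assms by (simp add: power_int_add)
  then show ?thesis
    using \<open>t \<noteq> 0\<close> by (simp add: gen_fib_def power_int_add algebra_simps)
qed

lemma gen_fib_binet:
  fixes \<alpha> \<beta> :: complex
  assumes "gen_fib G" "\<alpha>\<^sup>2 = \<alpha> + 1" "\<beta>\<^sup>2 = \<beta> + 1" "\<alpha> \<noteq> \<beta>"
  obtains A B where "\<And>m. G m = A * \<alpha> powi m + B * \<beta> powi m"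
proof
  \<comment> \<open>Cramer's rule for A + B = \<open>G 0\<close> and A \<alpha> + B \<beta> =
    \<open>G 1\<close>; the determinant is nonzero because the roots differ.\<close>
  define A where "A = (G 1 - \<beta> * G 0) / (\<alpha> - \<beta>)"
  define B where "B = (\<alpha> * G 0 - G 1) / (\<alpha> - \<beta>)"
  show "G m = A * \<alpha> powi m + B * \<beta> powi m" for m
  proof (rule gen_fib_eqI[where H = "\<lambda>m. A * \<alpha> powi m + B * \<beta> powi m"])
    show "gen_fib (\<lambda>m. A * \<alpha> powi m + B * \<beta> powi m)"
      using assms by (intro gen_fib_lincomb gen_fib_powi)
    show "G 0 = A * \<alpha> powi 0 + B * \<beta> powi 0" "G 1 = A * \<alpha> powi 1 + B * \<beta> powi 1"
      using assms(4) by (simp_all add: A_def B_def divide_simps) (simp_all add: algebra_simps)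
  qed fact
qed

lemma lucas_binet:
  fixes \<alpha> \<beta> :: complex
  assumes "\<alpha>\<^sup>2 = \<alpha> + 1" "\<beta>\<^sup>2 = \<beta> + 1" "\<alpha> + \<beta> = 1"
  shows "of_int (lucas m) = \<alpha> powi m + \<beta> powi m"
proof (rule gen_fib_eqI[where H = "\<lambda>m. \<alpha> powi m + \<beta> powi m"])
  show "gen_fib (\<lambda>m. of_int (lucas m))"
    by (simp add: gen_fib_def lucas_rec)
  show "gen_fib (\<lambda>m. \<alpha> powi m + \<beta> powi m)"
    using gen_fib_lincomb[OF gen_fib_powi gen_fib_powi, of \<alpha> \<beta> 1 1] assms by simp
qed (use assms in \<open>simp_all add: lucas_0 lucas_1\<close>)

lemma golden_ratio_complex:
  obtains \<alpha> \<beta> :: complex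
  where "\<alpha>\<^sup>2 = \<alpha> + 1" "\<beta>\<^sup>2 = \<beta> + 1" "\<alpha> \<noteq> \<beta>" "\<alpha> + \<beta> = 1" "\<alpha> * \<beta> = -1"
proof
  define r :: complex where "r = of_real (sqrt 5)"
  have r: "r * r = 5" by (simp add: r_def flip: of_real_mult)
  show "((1 + r) / 2)\<^sup>2 = (1 + r) / 2 + 1" "((1 - r) / 2)\<^sup>2 = (1 - r) / 2 + 1"
    "(1 + r) / 2 * ((1 - r) / 2) = - 1"
    using r by (simp_all add: power2_eq_square field_simps)
  show "(1 + r) / 2 + (1 - r) / 2 = 1" by (simp add: field_simps)
  show "(1 + r) / 2 \<noteq> (1 - r) / 2" using r by auto
qed

lemma fibP_lincomb:
  "fibP (\<lambda>m. A * G m + B * H m) a b x v w = A * fibP G a b x v w + B * fibP H a b x v w"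
  by (simp add: fibP_def sum_distrib_left algebra_simps sum.distrib)

text \<open>The binomial theorem in disguise. The factor \<open>x ^ w\<close> accompanies every
  \<open>P v w\<close> in the target formula, and here it merges with \<open>t powi (b * w)\<close>
  into a power of \<open>x * t powi b\<close>.\<close>

lemma fibP_powi:
  assumes "t * s = -1"
  shows "x ^ w * fibP ((powi) t) a b x v w
    = t powi a * (x * t powi b) ^ w * (1 - x * s powi b) ^ v"
proof -
  have "t \<noteq> 0" using assms by auto
  then have s: "s = (-1) * inverse t" using assms by (simp add: field_simps)
  have sb: "s powi b = (-1) powi b * inverse (t powi b)"
    unfolding s power_int_mult_distrib power_int_inverse ..
  \<comment> \<open>Since s = -1/t, the signs (-1)^(bk) turn t^(-bk) into s^(bk); the remaining
    (-1)^k becomes the minus sign in the base.\<close>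
  have "(-1) powi ((b + 1) * int k) * x ^ k * t powi (a + b * int w - b * int k)
      = t powi a * (t powi b) ^ w * (- (x * s powi b)) ^ k" for k
    using \<open>t \<noteq> 0\<close>
    by (simp add: sb power_int_add power_int_diff power_int_mult power_mult_distrib
        power_inverse divide_inverse power_minus[of "x * _"] power_minus[of "(-1) powi b"])
  then have "fibP ((powi) t) a b x v w
      = t powi a * (t powi b) ^ w * (\<Sum>k\<le>v. of_nat (v choose k) * (- (x * s powi b)) ^ k * 1 ^ (v - k))"
    by (simp add: fibP_def sum_distrib_left atLeast0AtMost mult.assoc mult.left_commute)
  also have "\<dots> = t powi a * (t powi b) ^ w * (1 - x * s powi b) ^ v"
    using binomial_ring[of "- (x * s powi b)" 1 v] by simp
  finally show ?thesis by (simp add: power_mult_distrib)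
qed

text \<open>Repeated summation by parts yields the right-hand side: over \<open>d ^ (j + 1)\<close>
  the coefficients of \<open>y ^ (n + 1 + j)\<close> and \<open>y ^ j\<close> are the j-th forward
  differences of k^5 at n + 1 and at 0. For j = 0 the latter vanishes, so the first term has no
  bracket.\<close>

lemma sum_power5_geometric:
  fixes y :: complex
  assumes "y \<noteq> 1"
  defines "d \<equiv> 1 - y"
  shows "(\<Sum>k=0..n. of_nat k ^ 5 * y ^ k) =
    - (1 / d) * (of_nat n + 1) ^ 5 * y ^ (n + 1)
    - 1 / d ^ 2 * ((5 * of_nat n ^ 4 + 30 * of_nat n ^ 3 + 70 * of_nat n ^ 2 + 75 * of_nat n + 31) * y ^ (n + 2) - y)
    - 10 / d ^ 3 * ((2 * of_nat n ^ 3 + 12 * of_nat n ^ 2 + 25 * of_nat n + 18) * y ^ (n + 3) - 3 * y ^ 2)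
    - 30 / d ^ 4 * ((2 * of_nat n ^ 2 + 10 * of_nat n + 13) * y ^ (n + 4) - 5 * y ^ 3)
    - 120 / d ^ 5 * ((of_nat n + 3) * y ^ (n + 5) - 2 * y ^ 4)
    - 120 / d ^ 6 * (y ^ (n + 6) - y ^ 5)"
proof (induction n)
  case 0
  have "d \<noteq> 0" using assms by simp
  \<comment> \<open>With d as the only variable, clearing denominators leaves a polynomial
    identity.\<close>
  have y: "y = 1 - d" by (simp add: d_def)
  show ?case
    using \<open>d \<noteq> 0\<close> unfolding y by (simp add: divide_simps) algebra
next
  case (Suc n)
  have "d \<noteq> 0" using assms by simp
  \<comment> \<open>All powers with exponent depending on n are reduced to the single
    \<open>y ^ n\<close>, so the step becomes a polynomial identity in N, Y and d.\<close>
  have y: "y ^ (n + i) = y ^ n * (1 - d) ^ i" for i by (simp add: d_def power_add)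
  have Sy: "y ^ (Suc n + i) = y ^ n * (1 - d) ^ Suc i" for i by (simp add: d_def power_add)
  have S: "y ^ Suc n = y ^ n * (1 - d)" by (simp add: d_def)
  define N Y where "N = (of_nat n :: complex)" and "Y = y ^ n"
  have N: "of_nat (Suc n) = N + 1" by (simp add: N_def)
  show ?case
    using \<open>d \<noteq> 0\<close>
    unfolding sum.atLeast0_atMost_Suc Suc.IH y Sy S N N_def[symmetric] Y_def[symmetric]
    by (simp add: divide_simps) algebra
qed

lemma sum_power5_powi:
  fixes t s x :: complex and a b :: int and n :: nat
  assumes ts: "t * s = -1"
  defines "\<Delta> \<equiv> (1 - x * t powi b) * (1 - x * s powi b)"
  defines "P \<equiv> fibP ((powi) t) a b x"
  defines "N \<equiv> of_nat n"
  assumes nz: "\<Delta> \<noteq> 0"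
  shows "(\<Sum>k=0..n. x ^ k * of_nat k ^ 5 * t powi (a + b * int k)) =
    - (1 / \<Delta>) * (N + 1) ^ 5 * x ^ (n + 1) * P 1 (n + 1)
    - 1 / \<Delta> ^ 2 * ((5 * N ^ 4 + 30 * N ^ 3 + 70 * N ^ 2 + 75 * N + 31) * x ^ (n + 2) * P 2 (n + 2)
                    - x * P 2 1)
    - 10 / \<Delta> ^ 3 * ((2 * N ^ 3 + 12 * N ^ 2 + 25 * N + 18) * x ^ (n + 3) * P 3 (n + 3)
                     - 3 * x ^ 2 * P 3 2)
    - 30 / \<Delta> ^ 4 * ((2 * N ^ 2 + 10 * N + 13) * x ^ (n + 4) * P 4 (n + 4)
                     - 5 * x ^ 3 * P 4 3)
    - 120 / \<Delta> ^ 5 * ((N + 3) * x ^ (n + 5) * P 5 (n + 5) - 2 * x ^ 4 * P 5 4)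
    - 120 / \<Delta> ^ 6 * (x ^ (n + 6) * P 6 (n + 6) - x ^ 5 * P 6 5)"
proof -
  define y d e c where "y = x * t powi b" and "d = 1 - y" and "e = 1 - x * s powi b"
    and "c = t powi a"
  have de: "\<Delta> = d * e" "d \<noteq> 0" "e \<noteq> 0" "y \<noteq> 1"
    using nz by (auto simp: \<Delta>_def d_def e_def y_def)
  have P: "x ^ w * P v w = c * y ^ w * e ^ v" for v w
    using fibP_powi[OF ts] by (simp add: P_def c_def y_def e_def)
  \<comment> \<open>The exponent of \<Delta> equals the first argument of \<open>P\<close>, so
    \<open>e ^ v\<close> cancels and only \<open>d ^ v\<close> remains below.\<close>
  have diff: "K / \<Delta> ^ v * (p * x ^ w * P v w - q * x ^ w' * P v w')
      = c * (K / d ^ v * (p * y ^ w - q * y ^ w'))" for K p q v w w'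
    using de(2,3) unfolding mult.assoc[of _ "x ^ _"] P de(1)
    by (simp add: field_simps)
  have single: "- (1 / \<Delta>) * p * x ^ w * P 1 w = c * (- (1 / d) * p * y ^ w)" for p w
    using de(2,3) unfolding mult.assoc[of _ "x ^ _"] P de(1)
    by (simp add: field_simps)
  have "t \<noteq> 0" using ts by auto
  then have "(\<Sum>k=0..n. x ^ k * of_nat k ^ 5 * t powi (a + b * int k))
      = c * (\<Sum>k=0..n. of_nat k ^ 5 * y ^ k)"
    by (simp add: sum_distrib_left c_def y_def power_int_add power_int_mult power_mult_distrib mult_ac)
  also note sum_power5_geometric[OF \<open>y \<noteq> 1\<close>, of n, folded d_def N_def]
  finally show ?thesis
    \<comment> \<open>The two specialised forms of \<open>diff\<close> match the brackets with
      implicit factors: the boundary term \<open>x * P 2 1\<close>, and the last bracket, where both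
      coefficients are 1.\<close>
    by (simp only: single diff diff[where q = 1 and w' = 1, unfolded mult_1_left power_one_right]
        diff[where p = 1 and q = 1, unfolded mult_1_left] right_diff_distrib[of c])
qed

theorem mainTheorem6:
  fixes G :: "int \<Rightarrow> complex" and a b :: int and n :: nat and x \<Delta> :: complex
    and P :: "nat \<Rightarrow> nat \<Rightarrow> complex" and N :: complex
  assumes G: "gen_fib G"
  defines "\<Delta> \<equiv> 1 - of_int (lucas b) * x + (-1) powi b * x ^ 2"
  defines "P \<equiv> fibP G a b x"
  defines "N \<equiv> of_nat n"
  assumes nz: "\<Delta> \<noteq> 0"
  shows "(\<Sum>k=0..n. x ^ k * of_nat k ^ 5 * G (a + b * int k)) =
    - (1 / \<Delta>) * (N + 1) ^ 5 * x ^ (n + 1) * P 1 (n + 1)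
    - 1 / \<Delta> ^ 2 * ((5 * N ^ 4 + 30 * N ^ 3 + 70 * N ^ 2 + 75 * N + 31) * x ^ (n + 2) * P 2 (n + 2)
                    - x * P 2 1)
    - 10 / \<Delta> ^ 3 * ((2 * N ^ 3 + 12 * N ^ 2 + 25 * N + 18) * x ^ (n + 3) * P 3 (n + 3)
                     - 3 * x ^ 2 * P 3 2)
    - 30 / \<Delta> ^ 4 * ((2 * N ^ 2 + 10 * N + 13) * x ^ (n + 4) * P 4 (n + 4)
                     - 5 * x ^ 3 * P 4 3)
    - 120 / \<Delta> ^ 5 * ((N + 3) * x ^ (n + 5) * P 5 (n + 5) - 2 * x ^ 4 * P 5 4)
    - 120 / \<Delta> ^ 6 * (x ^ (n + 6) * P 6 (n + 6) - x ^ 5 * P 6 5)"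
proof -
  obtain \<alpha> \<beta> :: complex where
    roots: "\<alpha>\<^sup>2 = \<alpha> + 1" "\<beta>\<^sup>2 = \<beta> + 1" "\<alpha> \<noteq> \<beta>" "\<alpha> + \<beta> = 1" and \<alpha>\<beta>: "\<alpha> * \<beta> = -1"
    by (rule golden_ratio_complex)
  obtain A B where AB: "\<And>m. G m = A * \<alpha> powi m + B * \<beta> powi m"
    using gen_fib_binet[OF G] roots by blast
  \<comment> \<open>Together with Binet's formula for \<open>lucas b\<close>, this identifies
    \<Delta> as the product of the two linear factors.\<close>
  have "\<alpha> powi b * \<beta> powi b = (-1) powi b"
    using \<alpha>\<beta> by (simp flip: power_int_mult_distrib)
  from this[symmetric] have \<Delta>: "\<Delta> = (1 - x * \<alpha> powi b) * (1 - x * \<beta> powi b)"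
    by (simp add: \<Delta>_def lucas_binet[OF roots(1,2,4)] algebra_simps power2_eq_square)
  \<comment> \<open>The swapped order fits the application with t = \<beta> and s = \<alpha>; both
    roots share the same \<Delta>.\<close>
  then have \<Delta>': "\<Delta> = (1 - x * \<beta> powi b) * (1 - x * \<alpha> powi b)"
    by (simp add: mult.commute)
  have \<beta>\<alpha>: "\<beta> * \<alpha> = -1" using \<alpha>\<beta> by (simp add: mult.commute)
  have "G = (\<lambda>m. A * \<alpha> powi m + B * \<beta> powi m)" using AB by blast
  then have P: "P v w = A * fibP ((powi) \<alpha>) a b x v w + B * fibP ((powi) \<beta>) a b x v w" for v w
    unfolding P_def by (simp add: fibP_lincomb)
  have sum_split: "(\<Sum>k=0..n. x ^ k * of_nat k ^ 5 * G (a + b * int k))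
      = A * (\<Sum>k=0..n. x ^ k * of_nat k ^ 5 * \<alpha> powi (a + b * int k))
      + B * (\<Sum>k=0..n. x ^ k * of_nat k ^ 5 * \<beta> powi (a + b * int k))"
    unfolding AB by (simp add: sum_distrib_left algebra_simps sum.distrib)
  show ?thesis
    \<comment> \<open>Both sides are now the same combination, with weights A and B, of the
      identities for the two roots.\<close>
    unfolding sum_split P N_def
      sum_power5_powi[OF \<alpha>\<beta> nz[unfolded \<Delta>], folded \<Delta>]
      sum_power5_powi[OF \<beta>\<alpha> nz[unfolded \<Delta>'], folded \<Delta>']
    by algebra
qed

end
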